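(* Let $X$ be a Hausdorff topological space, $Y$ a metrisable $\sigma$-locally compact space, and $f:X\to Y$ a function whose graph is closed in $X\times Y$. Then there exists a function $\hat f:X\to[0,+\infty)$ whose graph is closed in $X\times[0,+\infty)$ such that $D(f)=D(\hat f)$ and the graph of $\hat f$ is homeomorphic to the graph of $f$.
   Context: For a function $g$ between topological spaces, $D(g)$ denotes the set of all points of discontinuity of $g$. Graphs carry the subspace topology of the product of domain and codomain. A space is $\sigma$-locally compact if it is locally compact and $\sigma$-compact (for metrisable $Y$ this is equivalent to the existence of a metric inducing the topology of $Y$ for which every bounded closed subset is compact). *)

theory Defs
  imports "HOL-Analysis.Analysis"
begin

definition sigma_compact_space :: "'a topology \<Rightarrow> bool" where
  "sigma_compact_space X \<longleftrightarrow>
     (\<exists>K :: nat \<Rightarrow> 'a set. (\<forall>n. compactin X (K n)) \<and> (\<Union>n. K n) = topspace X)"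

definition sigma_locally_compact_space :: "'a topology \<Rightarrow> bool" where
  "sigma_locally_compact_space X \<longleftrightarrow> locally_compact_space X \<and> sigma_compact_space X"

definition graph_of :: "'a topology \<Rightarrow> ('a \<Rightarrow> 'b) \<Rightarrow> ('a \<times> 'b) set" where
  "graph_of X f = {(x, y). x \<in> topspace X \<and> y = f x}"

definition graph_topology :: "'a topology \<Rightarrow> 'b topology \<Rightarrow> ('a \<Rightarrow> 'b) \<Rightarrow> ('a \<times> 'b) topology" where
  "graph_topology X Y f = subtopology (prod_topology X Y) (graph_of X f)"

text \<open>
  The predicate \<^const>\<open>topcontinuous_at\<close> also requires the function to map the whole of
  \<^term>\<open>topspace X\<close> into \<^term>\<open>topspace Y\<close>, so the following is the set of discontinuities
  only for such functions.
\<close>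
definition discontinuities :: "'a topology \<Rightarrow> 'b topology \<Rightarrow> ('a \<Rightarrow> 'b) \<Rightarrow> 'a set" where
  "discontinuities X Y f = {x \<in> topspace X. \<not> topcontinuous_at X Y f x}"

end

theory Submission
  imports Defs
begin

text \<open>
  The function \<^term>\<open>g\<close> is \<^term>\<open>\<phi> \<circ> f\<close>, where \<^term>\<open>\<phi>\<close> is a continuous real function on
  \<^term>\<open>Y\<close> that is proper, in the sense that its sublevel sets
  \<^term>\<open>{y \<in> topspace Y. \<phi> y \<le> t}\<close> are compact. Such a \<^term>\<open>\<phi>\<close> exists because \<^term>\<open>Y\<close> is
  locally compact and $\sigma$-compact: it is the reciprocal of a positive function vanishing at
  infinity (\<open>exists_proper_function\<close>).

  Replacing \<^term>\<open>f\<close> by \<^term>\<open>\<phi> \<circ> f\<close> loses the values of \<^term>\<open>f\<close>, but no topological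
  information. A function with closed graph is continuous wherever its values stay locally in a
  compact set, and by properness the values of \<^term>\<open>f\<close> do so as soon as those of
  \<^term>\<open>\<phi> \<circ> f\<close> are locally bounded. Hence \<^term>\<open>f\<close> is continuous wherever \<^term>\<open>\<phi> \<circ> f\<close> is
  (\<open>topcontinuous_at_of_proper_compose\<close>), and the two functions have the same
  discontinuities. Closedness of the graph also survives: a limit point $(x, t)$ of the graph of
  \<^term>\<open>\<phi> \<circ> f\<close> only involves values of \<^term>\<open>f\<close> in a compact set
  (\<open>closed_graph_proper_compose\<close>).

  The same principle gives the homeomorphism of the graphs. The only question is whether
  $(x, \varphi(f(x))) \mapsto (x, f(x))$ is continuous. Its second component, regarded as a function
  on the graph of \<^term>\<open>\<phi> \<circ> f\<close>, has closed graph, and composed with \<^term>\<open>\<phi>\<close> it becomes the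
  second projection, which is continuous; so it is itself continuous.
\<close>

section \<open>Proper functions on sigma-locally compact spaces\<close>

text \<open>
  Urysohn functions $v_n$ that are $1$ on the $n$-th set of a compact cover and have compact support
  add up to $\psi = \sum_n 2^{-n-1} v_n$. The sum is continuous by uniform convergence, positive
  because the compact sets cover, and vanishes at infinity because every partial sum has compact
  support. So its reciprocal is proper.
\<close>

lemma exists_proper_function:
  fixes Y :: "'b topology"
  assumes haus: "Hausdorff_space Y" and slc: "sigma_locally_compact_space Y"
  obtains \<phi> :: "'b \<Rightarrow> real" where
    "continuous_map Y euclideanreal \<phi>"
    "\<And>y. y \<in> topspace Y \<Longrightarrow> 0 \<le> \<phi> y"
    "\<And>t. compactin Y {y \<in> topspace Y. \<phi> y \<le> t}"
proof -
  have lc: "locally_compact_space Y"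
    using slc by (simp add: sigma_locally_compact_space_def)
  obtain K :: "nat \<Rightarrow> 'b set" where K: "\<And>n. compactin Y (K n)" and UK: "(\<Union>n. K n) = topspace Y"
    using slc unfolding sigma_locally_compact_space_def sigma_compact_space_def by blast
  have cr: "completely_regular_space Y"
    using locally_compact_regular_imp_completely_regular_space[OF lc] haus by blast
  have "\<exists>v L. continuous_map Y (top_of_set {0..1::real}) v \<and> compactin Y L \<and>
              (\<forall>y\<in>K n. v y = 1) \<and> (\<forall>y\<in>topspace Y - L. v y = 0)" for n
  proof -
    obtain U L where U: "openin Y U" and L: "compactin Y L" and sub: "K n \<subseteq> U" "U \<subseteq> L"
      using locally_compact_space_compact_closed_compact[of Y] haus lc K[of n] by metis
    have "closedin Y (topspace Y - U)" "disjnt (K n) (topspace Y - U)"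
      using U sub by (auto simp: disjnt_def)
    then obtain v where "continuous_map Y (top_of_set {0..1::real}) v"
        "v ` (topspace Y - U) \<subseteq> {0}" "v ` K n \<subseteq> {1}"
      using Urysohn_completely_regular_compact_closed[OF zero_le_one cr K[of n]] by metis
    with L sub show ?thesis by (intro exI[of _ v] exI[of _ L]) blast
  qed
  then obtain v L where
        v: "\<And>n. continuous_map Y (top_of_set {0..1::real}) (v n)"
    and L: "\<And>n. compactin Y (L n)"
    and v1: "\<And>n y. y \<in> K n \<Longrightarrow> v n y = 1"
    and v0: "\<And>n y. y \<in> topspace Y \<Longrightarrow> y \<notin> L n \<Longrightarrow> v n y = 0"
    by (metis Diff_iff)
  have v_cont: "continuous_map Y euclideanreal (v n)" for n
    using v[of n] by (simp add: continuous_map_in_subtopology)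
  have v_range: "0 \<le> v n y" "v n y \<le> 1" if "y \<in> topspace Y" for n y
    using v[of n] that by (auto simp: continuous_map_in_subtopology Pi_iff)

  define w where "w n y = (1/2) ^ Suc n * v n y" for n y
  have w_nonneg: "0 \<le> w n y" and w_le: "w n y \<le> (1/2) ^ Suc n" if "y \<in> topspace Y" for n y
    using v_range[OF that, of n] by (auto simp: w_def mult_left_le)
  have geo: "summable (\<lambda>n. (1/2::real) ^ Suc n)"
    using power_half_series sums_summable by blast
  have w_summable: "summable (\<lambda>n. w n y)" if "y \<in> topspace Y" for y
    using w_nonneg[OF that] w_le[OF that] by (intro summable_comparison_test'[OF geo, of 0]) auto
  define \<psi> where "\<psi> y = (\<Sum>n. w n y)" for y

  have unif: "uniform_limit (topspace Y) (\<lambda>N y. \<Sum>n<N. w n y) \<psi> sequentially"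
    unfolding \<psi>_def
    by (rule Weierstrass_m_test[OF _ geo]) (simp add: w_nonneg w_le del: power_Suc)
  have cont_sum: "continuous_map Y euclideanreal (\<lambda>y. \<Sum>n<N. w n y)" for N
    unfolding w_def by (intro continuous_map_sum continuous_map_real_mult_left v_cont) auto
  have \<psi>_cont: "continuous_map Y euclideanreal \<psi>"
    using Met_TC.continuous_map_uniform_limit[of Y "\<lambda>N y. \<Sum>n<N. w n y" sequentially \<psi>]
          cont_sum unif
    by (simp add: uniform_limit_iff)

  have \<psi>_pos: "0 < \<psi> y" if y: "y \<in> topspace Y" for y
  proof -
    obtain n where "y \<in> K n" using UK y by blast
    then have "0 < w n y" by (simp add: w_def v1)
    then show ?thesis
      unfolding \<psi>_def using w_summable[OF y] w_nonneg[OF y] by (meson suminf_pos2)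
  qed

  have \<psi>_small: "\<psi> y \<le> (1/2) ^ N" if y: "y \<in> topspace Y" and out: "\<And>n. n < N \<Longrightarrow> y \<notin> L n" for y N
  proof -
    have "\<psi> y = (\<Sum>n. w (n + N) y) + (\<Sum>n<N. w n y)"
      unfolding \<psi>_def by (rule suminf_split_initial_segment[OF w_summable[OF y]])
    also have "(\<Sum>n<N. w n y) = 0"
      using v0[OF y] out by (simp add: w_def)
    also have "(\<Sum>n. w (n + N) y) \<le> (\<Sum>n. (1/2) ^ N * (1/2) ^ Suc n)"
    proof (rule suminf_le)
      show "w (n + N) y \<le> (1/2) ^ N * (1/2) ^ Suc n" for n
        using w_le[OF y, of "n + N"] by (simp add: power_add mult.commute)
      show "summable (\<lambda>n. w (n + N) y)"
        by (rule summable_ignore_initial_segment[OF w_summable[OF y]])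
      show "summable (\<lambda>n. (1/2::real) ^ N * (1/2) ^ Suc n)"
        by (rule summable_mult[OF geo])
    qed
    also have "(\<Sum>n. (1/2::real) ^ N * (1/2) ^ Suc n) = (1/2) ^ N"
      using sums_unique[OF sums_mult[OF power_half_series, of "(1/2) ^ N"]] by simp
    finally show ?thesis by simp
  qed

  show thesis
  proof
    show cont: "continuous_map Y euclideanreal (\<lambda>y. inverse (\<psi> y))"
      using \<psi>_cont \<psi>_pos by (intro continuous_map_real_inverse) force+
    show "0 \<le> inverse (\<psi> y)" if "y \<in> topspace Y" for y
      using \<psi>_pos[OF that] by simp
    show "compactin Y {y \<in> topspace Y. inverse (\<psi> y) \<le> t}" for t
    proof -
      \<comment> \<open>Replacing \<^term>\<open>t\<close> by \<^term>\<open>max t 1\<close> gives a level with a positive reciprocal, which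
          bounds \<^term>\<open>\<psi>\<close> from below on the sublevel set.\<close>
      obtain N where N: "(1/2::real) ^ N < inverse (max t 1)"
        using real_arch_pow_inv[of "inverse (max t 1)" "1/2"] by (auto simp: less_max_iff_disj)
      have "{y \<in> topspace Y. inverse (\<psi> y) \<le> t} \<subseteq> (\<Union>n<N. L n)"
      proof (rule subsetI, rule ccontr)
        fix y assume y: "y \<in> {y \<in> topspace Y. inverse (\<psi> y) \<le> t}" and "y \<notin> (\<Union>n<N. L n)"
        then have "\<psi> y < inverse (max t 1)"
          using \<psi>_small[of y N] N by auto
        then have "max t 1 < inverse (\<psi> y)"
          using \<psi>_pos y less_imp_inverse_less by fastforce
        with y show False by auto
      qed
      moreover have "compactin Y (\<Union>n<N. L n)"
        by (rule compactin_Union) (auto simp: L)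
      moreover have "closedin Y {y \<in> topspace Y. inverse (\<psi> y) \<le> t}"
        using closedin_continuous_map_preimage[OF cont, of "{..t}"] by simp
      ultimately show ?thesis
        by (meson closed_compactin)
    qed
  qed
qed

section \<open>Functions with closed graph\<close>

text \<open>
  The preimage of \<^term>\<open>F\<close> is the projection of the part of the graph lying over \<^term>\<open>F\<close>, and
  projecting along a compact factor is a closed map.
\<close>

lemma closedin_vimage_compactin_of_closed_graph:
  assumes maps_to: "f \<in> topspace X \<rightarrow> topspace Y"
    and graph: "closedin (prod_topology X Y) (graph_of X f)"
    and F: "compactin Y F"
  shows "closedin X {x \<in> topspace X. f x \<in> F}"
proof -
  have FY: "F \<subseteq> topspace Y"
    using F by (rule compactin_subset_topspace)
  have "closedin (prod_topology X (subtopology Y F)) ((topspace X \<times> F) \<inter> graph_of X f)"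
    using graph by (auto simp: prod_topology_subtopology closedin_subtopology graph_of_def)
  moreover have "compact_space (subtopology Y F)"
    using F by (rule compact_space_subtopology)
  ultimately have "closedin X (fst ` ((topspace X \<times> F) \<inter> graph_of X f))"
    using closed_map_fst closed_map_def by blast
  moreover have "fst ` ((topspace X \<times> F) \<inter> graph_of X f) = {x \<in> topspace X. f x \<in> F}"
    by (force simp: graph_of_def)
  ultimately show ?thesis by simp
qed

text \<open>
  If \<^term>\<open>\<phi> \<circ> f\<close> is continuous at \<^term>\<open>x\<close>, then near \<^term>\<open>x\<close> the values of \<^term>\<open>f\<close> lie in a
  compact sublevel set of \<^term>\<open>\<phi>\<close>. The part of it outside a neighbourhood of \<^term>\<open>f x\<close> is
  compact, so its preimage is closed and stays away from \<^term>\<open>x\<close>.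
\<close>

lemma topcontinuous_at_of_proper_compose:
  fixes \<phi> :: "'b \<Rightarrow> real"
  assumes maps_to: "f \<in> topspace X \<rightarrow> topspace Y"
    and graph: "closedin (prod_topology X Y) (graph_of X f)"
    and proper: "\<And>t. compactin Y {y \<in> topspace Y. \<phi> y \<le> t}"
    and cont: "topcontinuous_at X euclideanreal (\<phi> \<circ> f) x"
  shows "topcontinuous_at X Y f x"
  unfolding topcontinuous_at_def
proof (intro conjI allI impI)
  show x: "x \<in> topspace X"
    using cont by (simp add: topcontinuous_at_def)
  show "f \<in> topspace X \<rightarrow> topspace Y" by (rule maps_to)
  fix V assume V: "openin Y V \<and> f x \<in> V"
  define C where "C = {y \<in> topspace Y. \<phi> y \<le> \<phi> (f x) + 1}"
  have "compactin Y (C \<inter> (topspace Y - V))"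
    unfolding C_def using V proper by (intro compact_Int_closedin) auto
  then have "closedin X {z \<in> topspace X. f z \<in> C \<inter> (topspace Y - V)}"
    by (rule closedin_vimage_compactin_of_closed_graph[OF maps_to graph])
  then have open_U1: "openin X (topspace X - {z \<in> topspace X. f z \<in> C \<inter> (topspace Y - V)})"
    by blast
  define U1 where "U1 = topspace X - {z \<in> topspace X. f z \<in> C \<inter> (topspace Y - V)}"
  have "openin euclideanreal {..<\<phi> (f x) + 1}" "(\<phi> \<circ> f) x \<in> {..<\<phi> (f x) + 1}"
    by auto
  then obtain U2 where U2: "openin X U2" "x \<in> U2" "\<forall>z\<in>U2. (\<phi> \<circ> f) z \<in> {..<\<phi> (f x) + 1}"
    using cont unfolding topcontinuous_at_def by meson
  show "\<exists>U. openin X U \<and> x \<in> U \<and> (\<forall>z\<in>U. f z \<in> V)"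
  proof (intro exI conjI ballI)
    show "openin X (U1 \<inter> U2)"
      unfolding U1_def using open_U1 U2(1) by (rule openin_Int)
    show "x \<in> U1 \<inter> U2"
      using x V U2(2) by (simp add: U1_def)
    fix z assume z: "z \<in> U1 \<inter> U2"
    then have "f z \<in> topspace Y" "f z \<in> C"
      using U2(3) maps_to by (auto simp: U1_def C_def Pi_iff less_imp_le)
    with z show "f z \<in> V" by (simp add: U1_def)
  qed
qed

lemma topcontinuous_at_compose_continuous_map:
  assumes "topcontinuous_at X Y f x" and \<phi>: "continuous_map Y Z \<phi>"
  shows "topcontinuous_at X Z (\<phi> \<circ> f) x"
  unfolding topcontinuous_at_def
proof (intro conjI allI impI)
  show "x \<in> topspace X" "\<phi> \<circ> f \<in> topspace X \<rightarrow> topspace Z"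
    using assms by (auto simp: topcontinuous_at_def continuous_map_def Pi_iff)
  fix V assume V: "openin Z V \<and> (\<phi> \<circ> f) x \<in> V"
  then have "openin Y {y \<in> topspace Y. \<phi> y \<in> V}"
    using \<phi> by (simp add: openin_continuous_map_preimage)
  moreover have "f x \<in> {y \<in> topspace Y. \<phi> y \<in> V}"
    using assms(1) V by (auto simp: topcontinuous_at_def Pi_iff)
  ultimately obtain U where "openin X U" "x \<in> U" "\<forall>z\<in>U. f z \<in> {y \<in> topspace Y. \<phi> y \<in> V}"
    using assms(1) unfolding topcontinuous_at_def by meson
  then show "\<exists>U. openin X U \<and> x \<in> U \<and> (\<forall>z\<in>U. (\<phi> \<circ> f) z \<in> V)" by auto
qed

lemma topcontinuous_at_subtopology_iff:
  assumes "f \<in> topspace X \<rightarrow> S"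
  shows "topcontinuous_at X (subtopology Y S) f x \<longleftrightarrow> topcontinuous_at X Y f x"
proof
  assume L: "topcontinuous_at X (subtopology Y S) f x"
  show "topcontinuous_at X Y f x"
    using topcontinuous_at_compose_continuous_map[OF L, of Y id] by simp
next
  assume R: "topcontinuous_at X Y f x"
  show "topcontinuous_at X (subtopology Y S) f x"
    unfolding topcontinuous_at_def
  proof (intro conjI allI impI)
    show x: "x \<in> topspace X" "f \<in> topspace X \<rightarrow> topspace (subtopology Y S)"
      using R assms by (auto simp: topcontinuous_at_def Pi_iff)
    fix V assume "openin (subtopology Y S) V \<and> f x \<in> V"
    then obtain W where W: "openin Y W" "V = W \<inter> S" "f x \<in> W"
      by (auto simp: openin_subtopology)
    then obtain U where U: "openin X U" "x \<in> U" "\<forall>z\<in>U. f z \<in> W"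
      using R unfolding topcontinuous_at_def by meson
    have "\<forall>z\<in>U. f z \<in> V"
    proof
      fix z assume z: "z \<in> U"
      then have "z \<in> topspace X"
        using openin_subset[OF U(1)] by auto
      with assms z U(3) show "f z \<in> V"
        by (auto simp: W(2))
    qed
    with U(1,2) show "\<exists>U. openin X U \<and> x \<in> U \<and> (\<forall>z\<in>U. f z \<in> V)"
      by (intro exI[of _ U] conjI)
  qed
qed

text \<open>
  If \<^term>\<open>t \<noteq> \<phi> (f x)\<close>, choose a closed interval around \<^term>\<open>t\<close> that avoids
  \<^term>\<open>\<phi> (f x)\<close>. Its preimage under \<^term>\<open>\<phi>\<close> is compact, so the points that
  \<^term>\<open>\<phi> \<circ> f\<close> maps into the interval form a closed set not containing \<^term>\<open>x\<close>.
\<close>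

lemma closed_graph_proper_compose:
  fixes \<phi> :: "'b \<Rightarrow> real"
  assumes maps_to: "f \<in> topspace X \<rightarrow> topspace Y"
    and graph: "closedin (prod_topology X Y) (graph_of X f)"
    and \<phi>: "continuous_map Y euclideanreal \<phi>"
    and proper: "\<And>t. compactin Y {y \<in> topspace Y. \<phi> y \<le> t}"
  shows "closedin (prod_topology X euclideanreal) (graph_of X (\<phi> \<circ> f))"
proof -
  have "\<exists>T. openin (prod_topology X euclideanreal) T \<and> (x, t) \<in> T \<and>
            T \<subseteq> topspace X \<times> UNIV - graph_of X (\<phi> \<circ> f)"
    if x: "x \<in> topspace X" and t: "t \<noteq> \<phi> (f x)" for x t
  proof -
    define e where "e = \<bar>t - \<phi> (f x)\<bar> / 2"
    have e: "0 < e" "\<phi> (f x) \<notin> {t-e..t+e}"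
      using t by (auto simp: e_def abs_if field_simps split: if_splits)
    have "compactin Y ({y \<in> topspace Y. \<phi> y \<le> t + e} \<inter> {y \<in> topspace Y. \<phi> y \<in> {t-e..}})"
      using proper closedin_continuous_map_preimage[OF \<phi>, of "{t-e..}"]
      by (intro compact_Int_closedin) auto
    note closed = closedin_vimage_compactin_of_closed_graph[OF maps_to graph this]
    define U where "U = topspace X -
      {z \<in> topspace X. f z \<in> {y \<in> topspace Y. \<phi> y \<le> t + e} \<inter> {y \<in> topspace Y. \<phi> y \<in> {t-e..}}}"
    have "openin X U"
      unfolding U_def using closed by blast
    then have "openin (prod_topology X euclideanreal) (U \<times> {t-e<..<t+e})"
      by (simp add: openin_prod_Times_iff)
    moreover have "(x, t) \<in> U \<times> {t-e<..<t+e}"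
      using x e by (auto simp: U_def)
    moreover have "U \<times> {t-e<..<t+e} \<subseteq> topspace X \<times> UNIV - graph_of X (\<phi> \<circ> f)"
      using maps_to by (auto simp: U_def graph_of_def Pi_iff)
    ultimately show ?thesis by blast
  qed
  then have "openin (prod_topology X euclideanreal) (topspace X \<times> UNIV - graph_of X (\<phi> \<circ> f))"
    by (subst openin_subopen) (auto simp: graph_of_def)
  then show ?thesis
    by (auto simp: closedin_def graph_of_def)
qed

section \<open>Homeomorphism of the graphs\<close>

lemma topspace_graph_topology:
  "f \<in> topspace X \<rightarrow> topspace Y \<Longrightarrow> topspace (graph_topology X Y f) = graph_of X f"
  by (auto simp: graph_topology_def graph_of_def)

lemma homeomorphic_graph_proper_compose:
  fixes \<phi> :: "'b \<Rightarrow> real"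
  assumes maps_to: "f \<in> topspace X \<rightarrow> topspace Y"
    and graph: "closedin (prod_topology X Y) (graph_of X f)"
    and \<phi>: "continuous_map Y euclideanreal \<phi>"
    and proper: "\<And>t. compactin Y {y \<in> topspace Y. \<phi> y \<le> t}"
  shows "graph_topology X euclideanreal (\<phi> \<circ> f) homeomorphic_space graph_topology X Y f"
proof -
  define G where "G = graph_topology X euclideanreal (\<phi> \<circ> f)"
  have topG: "topspace G = graph_of X (\<phi> \<circ> f)"
    by (simp add: G_def topspace_graph_topology)
  have fst_cont: "continuous_map G X fst" and snd_cont: "continuous_map G euclideanreal snd"
    unfolding G_def graph_topology_def
    by (auto intro: continuous_map_from_subtopology continuous_map_fst continuous_map_snd)
  have maps: "f \<circ> fst \<in> topspace G \<rightarrow> topspace Y"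
    using maps_to by (auto simp: topG graph_of_def Pi_iff)

  \<comment> \<open>The graph of \<^term>\<open>f \<circ> fst\<close> is the preimage of the graph of \<^term>\<open>f\<close> under
      \<open>fst \<times> id\<close>, hence closed.\<close>
  have "continuous_map (prod_topology G Y) (prod_topology X Y) (\<lambda>p. (fst (fst p), snd p))"
    using continuous_map_compose[OF continuous_map_fst fst_cont, of Y] continuous_map_snd
    by (auto simp: continuous_map_pairwise o_def)
  from closedin_continuous_map_preimage[OF this graph]
  have "closedin (prod_topology G Y) (graph_of G (f \<circ> fst))"
    by (rule back_subst[where P = "closedin _"])
       (use maps_to in \<open>auto simp: topG graph_of_def Pi_iff\<close>)
  moreover have "continuous_map G euclideanreal (\<phi> \<circ> (f \<circ> fst))"
    by (rule continuous_map_eq[OF snd_cont]) (auto simp: topG graph_of_def)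
  ultimately have f_fst: "continuous_map G Y (f \<circ> fst)"
    using topcontinuous_at_of_proper_compose[OF maps _ proper]
    by (auto simp: continuous_map_eq_topcontinuous_at)

  have "continuous_map G (graph_topology X Y f) (\<lambda>p. (fst p, f (fst p)))"
    using fst_cont f_fst maps_to
    unfolding graph_topology_def
    by (auto simp: continuous_map_in_subtopology continuous_map_pairwise o_def topG graph_of_def Pi_iff)
  moreover have "continuous_map (graph_topology X Y f) G (\<lambda>p. (fst p, \<phi> (snd p)))"
  proof -
    have "continuous_map (prod_topology X Y) (prod_topology X euclideanreal)
            (\<lambda>p. (fst p, \<phi> (snd p)))"
      using continuous_map_compose[OF continuous_map_snd \<phi>, of X] continuous_map_fst
      by (auto simp: continuous_map_pairwise o_def)
    then show ?thesis
      unfolding G_def graph_topology_def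
      by (intro continuous_map_into_subtopology continuous_map_from_subtopology)
         (auto simp: graph_of_def)
  qed
  ultimately have "homeomorphic_maps G (graph_topology X Y f)
      (\<lambda>p. (fst p, f (fst p))) (\<lambda>p. (fst p, \<phi> (snd p)))"
    using maps_to
    by (auto simp: homeomorphic_maps_def topG topspace_graph_topology graph_of_def)
  then show ?thesis
    unfolding G_def homeomorphic_space_def by blast
qed

theorem theorem45:
  fixes X :: "'a topology" and Y :: "'b topology" and f :: "'a \<Rightarrow> 'b"
  assumes "Hausdorff_space X"
    and "metrizable_space Y"
    and "sigma_locally_compact_space Y"
    and "f \<in> topspace X \<rightarrow> topspace Y"
    and "closedin (prod_topology X Y) (graph_of X f)"
  shows "\<exists>g :: 'a \<Rightarrow> real.
           g \<in> topspace X \<rightarrow> {0..} \<and>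
           closedin (prod_topology X (top_of_set {0..})) (graph_of X g) \<and>
           discontinuities X Y f = discontinuities X (top_of_set {0..}) g \<and>
           graph_topology X (top_of_set {0..}) g homeomorphic_space graph_topology X Y f"
proof -
  obtain \<phi> :: "'b \<Rightarrow> real" where \<phi>: "continuous_map Y euclideanreal \<phi>"
    and nonneg: "\<And>y. y \<in> topspace Y \<Longrightarrow> 0 \<le> \<phi> y"
    and proper: "\<And>t. compactin Y {y \<in> topspace Y. \<phi> y \<le> t}"
    using exists_proper_function metrizable_imp_Hausdorff_space assms(2,3) by metis
  note fg = assms(4,5)
  define g where "g = \<phi> \<circ> f"
  have g: "g \<in> topspace X \<rightarrow> {0..}"
    using assms(4) nonneg by (auto simp: g_def Pi_iff)
  then have graph_sub: "graph_of X g \<subseteq> topspace X \<times> {0..}"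
    by (auto simp: graph_of_def)
  have prod_eq: "prod_topology X (top_of_set {0..}) =
      subtopology (prod_topology X euclideanreal) (topspace X \<times> {0..})"
    by (metis prod_topology_subtopology(2) subtopology_topspace subtopology_Times)
  have "closedin (prod_topology X (top_of_set {0..})) (graph_of X g)"
    using closed_graph_proper_compose[OF fg \<phi> proper] graph_sub
    by (auto simp: prod_eq g_def closedin_subtopology)
  moreover have "topcontinuous_at X Y f x \<longleftrightarrow> topcontinuous_at X (top_of_set {0..}) g x" for x
    unfolding topcontinuous_at_subtopology_iff[OF g] unfolding g_def
    by (rule iffI, erule topcontinuous_at_compose_continuous_map[OF _ \<phi>],
        erule topcontinuous_at_of_proper_compose[OF fg proper])
  then have "discontinuities X Y f = discontinuities X (top_of_set {0..}) g"
    by (simp add: discontinuities_def)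
  moreover have "graph_topology X (top_of_set {0..}) g = graph_topology X euclideanreal g"
    using graph_sub by (simp add: graph_topology_def prod_eq subtopology_subtopology Int_absorb1)
  then have "graph_topology X (top_of_set {0..}) g homeomorphic_space graph_topology X Y f"
    using homeomorphic_graph_proper_compose[OF fg \<phi> proper] by (simp add: g_def)
  ultimately show ?thesis
    using g by blast
qed

end
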